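(* Let $(m,n,k)\in\mathbb{Z}^3$ be such that $k^2-4mn>0$ is not a perfect square. The period $\Gamma(m,n,k)$ is palindromic and even if and only if the class $C(m,n,k)$ is $(m+n)$-symmetric.
   Context: The triple $\mathbf f=(m,n,k)\in\mathbb{Z}^3$ denotes the binary quadratic form $f(x,y)=mx^2+ny^2+kxy$. The class $C(\mathbf f)=C(m,n,k)$ is the orbit of $\mathbf f$ under the action of $\mathrm{SL}(2,\mathbb{Z})$ by linear changes of the variables $(x,y)$. For $\mathbf f=(m,n,k)$ define the conjugate $\overline{\mathbf f}=(m,n,-k)$, the adjoint $\mathbf f^*=(-n,-m,k)$ and the antipodal $\overline{\mathbf f}^*=(-n,-m,-k)$. If a class contains one form together with its image under one of these involutions, the whole class is invariant under that involution. A class is called $(m+n)$-symmetric if it is invariant under the adjoint involution but not under the conjugation nor the antipodal involution. For $k^2-4mn>0$ not a perfect square, put $\xi^{+}(\mathbf f)=\frac{-k+\sqrt{k^2-4mn}}{2m}$; its (regular) continued fraction is eventually periodic (the continued fraction of a negative number $\xi$ is written $-[\alpha_0,\alpha_1,\dots]$, where $[\alpha_0,\alpha_1,\dots]$ is that of $|\xi|$). $\Gamma(m,n,k)$ denotes its period, i.e. its minimal repeating block of positive integers, considered up to cyclic permutation. A period is even (odd) if its length is even (odd). A period is palindromic if some cyclic permutation of it is equal to the same sequence written backwards. *)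

theory Defs
  imports Complex_Main "HOL-Computational_Algebra.Nth_Powers"
begin

text \<open>The triple \<open>(m, n, k)\<close> stands for the form \<open>m x\<^sup>2 + n y\<^sup>2 + k x y\<close>; the last entry
  is the coefficient of the mixed term.\<close>

type_synonym form = "int \<times> int \<times> int"

fun form_eval :: "form \<Rightarrow> int \<Rightarrow> int \<Rightarrow> int" where
  "form_eval (m, n, k) x y = m * x\<^sup>2 + n * y\<^sup>2 + k * x * y"

definition form_class :: "form \<Rightarrow> form set" where
  "form_class f = {g. \<exists>a b c d :: int. a * d - b * c = 1 \<and>
     (\<forall>x y. form_eval g x y = form_eval f (a * x + b * y) (c * x + d * y))}"

fun conjugate_form :: "form \<Rightarrow> form" where
  "conjugate_form (m, n, k) = (m, n, - k)"

fun adjoint_form :: "form \<Rightarrow> form" where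
  "adjoint_form (m, n, k) = (- n, - m, k)"

fun antipodal_form :: "form \<Rightarrow> form" where
  "antipodal_form (m, n, k) = (- n, - m, - k)"

definition invariant_under :: "(form \<Rightarrow> form) \<Rightarrow> form set \<Rightarrow> bool" where
  "invariant_under \<sigma> C \<longleftrightarrow> \<sigma> ` C = C"

definition m_plus_n_symmetric :: "form set \<Rightarrow> bool" where
  "m_plus_n_symmetric C \<longleftrightarrow> invariant_under adjoint_form C \<and>
     \<not> invariant_under conjugate_form C \<and> \<not> invariant_under antipodal_form C"

fun xi_plus :: "form \<Rightarrow> real" where
  "xi_plus (m, n, k) =
     (- real_of_int k + sqrt (real_of_int (k\<^sup>2 - 4 * m * n))) / (2 * real_of_int m)"

text \<open>Complete and partial quotients of the regular continued fraction. The recursion is the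
  intended one only as long as the complete quotients are not integers, in particular for all
  irrational arguments.\<close>

primrec complete_quotient :: "real \<Rightarrow> nat \<Rightarrow> real" where
  "complete_quotient x 0 = x"
| "complete_quotient x (Suc i) = 1 / frac (complete_quotient x i)"

definition partial_quotient :: "real \<Rightarrow> nat \<Rightarrow> int" where
  "partial_quotient x i = \<lfloor>complete_quotient x i\<rfloor>"

definition repeating_block :: "(nat \<Rightarrow> 'a) \<Rightarrow> 'a list \<Rightarrow> bool" where
  "repeating_block a w \<longleftrightarrow> w \<noteq> [] \<and> (\<exists>N. \<forall>i. a (N + i) = w ! (i mod length w))"

text \<open>A period considered up to cyclic permutation is represented by the set of all minimal
  repeating blocks. Since a block may start anywhere in the periodic part, this set is closed
  under rotation, and it is a single cyclic class (\<open>minimal_blocks_eq_rotations\<close> below).\<close>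

definition minimal_blocks :: "(nat \<Rightarrow> 'a) \<Rightarrow> 'a list set" where
  "minimal_blocks a =
     {w. repeating_block a w \<and> (\<forall>v. repeating_block a v \<longrightarrow> length w \<le> length v)}"

lemma repeating_block_rotate:
  assumes "repeating_block a w"
  shows "repeating_block a (rotate r w)"
proof -
  from assms obtain N where w: "w \<noteq> []" and N: "\<And>i. a (N + i) = w ! (i mod length w)"
    unfolding repeating_block_def by blast
  have "a ((N + r) + i) = rotate r w ! (i mod length (rotate r w))" for i
    using N[of "r + i"] w by (simp add: nth_rotate add.assoc mod_simps)
  then show ?thesis
    unfolding repeating_block_def using w by (metis rotate_is_Nil_conv)
qed

lemma minimal_blocks_eq_rotations:
  assumes "w \<in> minimal_blocks a"
  shows "minimal_blocks a = range (\<lambda>r. rotate r w)"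
proof (intro subset_antisym subsetI)
  fix v assume v: "v \<in> minimal_blocks a"
  then have len: "length v = length w"
    using assms unfolding minimal_blocks_def by (simp add: le_antisym)
  from assms obtain N where w0: "w \<noteq> []" and N: "\<And>i. a (N + i) = w ! (i mod length w)"
    unfolding minimal_blocks_def repeating_block_def by blast
  from v obtain M where M: "\<And>i. a (M + i) = v ! (i mod length v)"
    unfolding minimal_blocks_def repeating_block_def by blast
  have pos: "length w > 0" using w0 by simp
  define r where "r = M + N * length w - N"
  have Nr: "N + r = M + N * length w"
    unfolding r_def using pos by (cases "length w") auto
  have "v = rotate r w"
  proof (rule nth_equalityI)
    fix i assume i: "i < length v"
    have "v ! i = a (M + (i + N * length w))"
      using M[of "i + N * length w"] i len by simp
    also have "M + (i + N * length w) = N + (r + i)" using Nr by simp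
    also have "a \<dots> = w ! ((r + i) mod length w)" by (rule N)
    also have "\<dots> = rotate r w ! i" using i len by (simp add: nth_rotate)
    finally show "v ! i = rotate r w ! i" .
  qed (simp add: len)
  then show "v \<in> range (\<lambda>r. rotate r w)" by blast
next
  fix v assume "v \<in> range (\<lambda>r. rotate r w)"
  then show "v \<in> minimal_blocks a"
    using assms repeating_block_rotate unfolding minimal_blocks_def by auto
qed

text \<open>For negative \<open>\<xi>\<close> the continued fraction is minus that of \<open>\<bar>\<xi>\<bar>\<close>, hence the absolute
  value.\<close>

definition Gamma_period :: "form \<Rightarrow> int list set" where
  "Gamma_period f = minimal_blocks (partial_quotient \<bar>xi_plus f\<bar>)"

text \<open>For an even period, palindromicity asks for one cyclic permutation that equals its own
  reversal. It is not enough that the reversal is a cyclic permutation: \<open>[a, b, c, b]\<close> with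
  \<open>a \<noteq> c\<close> is a rotation of its reversal, but none of its rotations is a palindrome. Both
  predicates are false on the empty set, that is, when there is no period.\<close>

definition palindromic_period :: "'a list set \<Rightarrow> bool" where
  "palindromic_period P \<longleftrightarrow> (\<exists>w\<in>P. rev w = w)"

definition even_period :: "'a list set \<Rightarrow> bool" where
  "even_period P \<longleftrightarrow> (\<exists>w\<in>P. even (length w))"

end

theory Submission
  imports Defs
begin

text \<open>
  Let integral matrices of determinant \<open>e = \<plusminus>1\<close> act on forms by \<open>f \<mapsto> e \<cdot> (f \<circ> A)\<close>. With this
  twist the root \<open>\<xi>\<^sup>+\<close> is carried along by the corresponding Moebius transformation, and for a fixed
  nonsquare discriminant it determines the form. So questions about classes of forms become
  questions about numbers modulo integral Moebius transformations. These are answered by Serret's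
  theorem in a version that keeps track of signs (\<open>tail_equiv_moebius\<close>): two irrational numbers
  related by a matrix of determinant \<open>e\<close> have continued fractions with a common tail, reached after
  \<open>i\<close> and \<open>j\<close> steps with \<open>(-1)\<^sup>i\<^sup>+\<^sup>j = e\<close>. For the roots of forms of the same discriminant the converse
  holds as well, and the result is a classification of forms by tails (\<open>gl_equiv_iff_tail_equiv\<close>).

  The adjoint form \<open>f\<^sup>*\<close> has the root \<open>-1/\<xi>\<^sup>-\<close>, and by an observation of Galois the expansion of
  this number is, in the periodic part, the expansion of \<open>\<xi>\<^sup>+\<close> read backwards
  (\<open>partial_quotient_adjoint\<close>). In terms of the twisted action, invariance under the antipodal
  involution means that \<open>f\<close> is equivalent to itself with determinant \<open>-1\<close>, while invariance under the
  adjoint and under the conjugation mean that \<open>f\<close> is equivalent to \<open>f\<^sup>*\<close> with determinant \<open>1\<close> and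
  \<open>-1\<close>, respectively. Any two of these imply the third, so \<open>(m+n)\<close>-symmetry amounts to invariance
  under the adjoint but not under the antipodal involution (\<open>m_plus_n_symmetric_iff\<close>).

  Antipodal invariance is an odd shift of the periodic sequence into itself, so it holds exactly if
  the period is odd (\<open>gl_equiv_self_iff_odd\<close>). Adjoint invariance is an even shift of the sequence into
  its reversal. If the period is even, such a shift has a centre of symmetry between two consecutive
  places, and the block around that centre is a palindrome (\<open>adjoint_imp_palindromic_block\<close>).
  Conversely, the form reached at the start of a palindromic block has the same expansion as its
  adjoint and is therefore equal to it (\<open>palindromic_block_imp_adjoint\<close>).
\<close>

section \<open>Regular continued fractions of irrational numbers\<close>

lemma frac_irrational:
  fixes x :: real
  assumes "x \<notin> \<rat>"
  shows "frac x \<notin> \<rat>" "0 < frac x" "frac x < 1"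
proof -
  show "frac x \<notin> \<rat>"
    using assms by (metis Rats_add Rats_of_int add.commute frac_def diff_add_cancel)
  show "0 < frac x"
    using assms Ints_subset_Rats by (auto simp: frac_gt_0_iff)
  show "frac x < 1" by (rule frac_lt_1)
qed

lemma Rats_one_divide_iff [simp]: "1 / x \<in> \<rat> \<longleftrightarrow> x \<in> \<rat>" for x :: real
  using Rats_inverse_iff[of x] by (simp add: inverse_eq_divide)

lemma complete_quotient_irrational:
  assumes "x \<notin> \<rat>"
  shows "complete_quotient x i \<notin> \<rat>"
  by (induction i) (use assms frac_irrational(1) in auto)

lemma complete_quotient_gt_1:
  assumes "x \<notin> \<rat>" "i > 0"
  shows "complete_quotient x i > 1"
proof -
  obtain j where "i = Suc j" using assms(2) gr0_implies_Suc by blast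
  then show ?thesis
    using frac_irrational[OF complete_quotient_irrational[OF assms(1), of j]] by simp
qed

lemma complete_quotient_add:
  "complete_quotient (complete_quotient x i) j = complete_quotient x (i + j)"
  by (induction j) auto

lemma partial_quotient_add:
  "partial_quotient (complete_quotient x i) j = partial_quotient x (i + j)"
  by (simp add: partial_quotient_def complete_quotient_add)

lemma complete_quotient_rec:
  assumes "x \<notin> \<rat>"
  shows "complete_quotient x i
    = of_int (partial_quotient x i) + 1 / complete_quotient x (Suc i)"
  by (simp add: partial_quotient_def frac_def)

text \<open>The integer part and the next complete quotient can be read off from any expansion
  \<open>a + 1 / z\<close> with \<open>z > 1\<close>; this is how all continued fractions below are identified.\<close>

lemma expansion_step:
  fixes z :: real
  assumes "x = of_int a + 1 / z" "z > 1"
  shows "\<lfloor>x\<rfloor> = a" "1 / frac x = z"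
proof -
  show a: "\<lfloor>x\<rfloor> = a"
    using assms by (simp add: floor_unique)
  show "1 / frac x = z"
    by (simp only: frac_def a) (simp add: assms(1))
qed

text \<open>Two numbers with the same partial quotients coincide, because passing to the second next
  complete quotients magnifies their distance at least fourfold, whereas numbers with the same
  integer part are less than \<open>1\<close> apart.\<close>

lemma same_partial_quotients_close:
  assumes "x \<notin> \<rat>" "y \<notin> \<rat>" "\<And>i. partial_quotient x i = partial_quotient y i"
  shows "\<bar>x - y\<bar> \<le> (1 / 4) ^ n"
  using assms
proof (induction n arbitrary: x y)
  case 0
  have "\<lfloor>x\<rfloor> = \<lfloor>y\<rfloor>" using "0.prems"(3)[of 0] by (simp add: partial_quotient_def)
  then show ?case by simp linarith
next
  case (Suc n)
  define u where "u = complete_quotient x"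
  define v where "v = complete_quotient y"
  define a where "a = partial_quotient x"
  have gt: "u (Suc i) > 1" "v (Suc i) > 1" for i
    unfolding u_def v_def using complete_quotient_gt_1 Suc.prems by blast+
  have ru: "u i = of_int (a i) + 1 / u (Suc i)" for i
    unfolding u_def a_def using complete_quotient_rec Suc.prems(1) by blast
  have rv: "v i = of_int (a i) + 1 / v (Suc i)" for i
    unfolding v_def a_def Suc.prems(3) using complete_quotient_rec Suc.prems(2) by blast
  have a1: "a 1 \<ge> 1"
    using gt(1)[of 0] unfolding a_def u_def by (simp add: partial_quotient_def le_floor_iff)
  have prod2: "2 \<le> t * s" if "t = of_int (a 1) + 1 / s" "s > 1" for t s :: real
  proof -
    have "t * s = of_int (a 1) * s + 1" using that by (simp add: field_simps)
    moreover have "1 * s \<le> of_int (a 1) * s"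
      using a1 that(2) by (intro mult_right_mono) auto
    ultimately show ?thesis using that(2) by linarith
  qed
  (* the two inner denominators contribute a factor of at least 2 each *)
  have U: "2 \<le> u 1 * u 2" and V: "2 \<le> v 1 * v 2"
    using prod2 ru[of 1] rv[of 1] gt[of 1] by (auto simp: numeral_2_eq_2)
  have step: "\<bar>u i - v i\<bar> = \<bar>u (Suc i) - v (Suc i)\<bar> / (u (Suc i) * v (Suc i))" for i
  proof -
    have "u i - v i = - (u (Suc i) - v (Suc i)) / (u (Suc i) * v (Suc i))"
      unfolding ru[of i] rv[of i] using gt[of i] by (simp add: field_simps)
    then show ?thesis using gt[of i] by (simp add: abs_divide abs_mult)
  qed
  have "\<bar>x - y\<bar> = \<bar>u 2 - v 2\<bar> / ((u 1 * u 2) * (v 1 * v 2))"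
    using step[of 0] step[of 1] by (simp add: u_def v_def numeral_2_eq_2 mult_ac)
  also have "\<dots> \<le> \<bar>u 2 - v 2\<bar> / (2 * 2)"
    using U V gt[of 0] gt[of 1]
    by (intro divide_left_mono mult_mono mult_pos_pos) (auto simp: numeral_2_eq_2)
  also have "\<dots> \<le> (1 / 4) ^ n / 4"
  proof -
    have "\<bar>u 2 - v 2\<bar> \<le> (1 / 4) ^ n"
      unfolding u_def v_def
      by (rule Suc.IH)
        (use Suc.prems complete_quotient_irrational in \<open>auto simp: partial_quotient_add\<close>)
    then show ?thesis by simp
  qed
  finally show ?case by simp
qed

lemma partial_quotients_inject:
  assumes "x \<notin> \<rat>" "y \<notin> \<rat>" "\<And>i. partial_quotient x i = partial_quotient y i"
  shows "x = y"
proof (rule ccontr)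
  assume "x \<noteq> y"
  then obtain n where "(1 / 4) ^ n < \<bar>x - y\<bar>"
    using real_arch_pow_inv[of "\<bar>x - y\<bar>" "1 / 4"] by auto
  then show False using same_partial_quotients_close[OF assms, of n] by simp
qed

section \<open>Serret's theorem with parity\<close>

text \<open>Equality of tails, graded by the parity of the shift between them. The sign \<open>e\<close> corresponds
  to the determinant of a matrix relating the two numbers.\<close>

definition tail_equiv :: "int \<Rightarrow> real \<Rightarrow> real \<Rightarrow> bool" where
  "tail_equiv e x y \<longleftrightarrow>
     (\<exists>i j. complete_quotient x i = complete_quotient y j \<and> (- 1) ^ (i + j) = e)"

lemma tail_equiv_sym: "tail_equiv e x y \<Longrightarrow> tail_equiv e y x"
  unfolding tail_equiv_def by (metis add.commute)

lemma tail_equiv_trans: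
  assumes "tail_equiv e x y" "tail_equiv e' y z"
  shows "tail_equiv (e * e') x z"
proof -
  obtain i j where 1: "complete_quotient x i = complete_quotient y j" "(- 1) ^ (i + j) = e"
    using assms(1) unfolding tail_equiv_def by blast
  obtain p q where 2: "complete_quotient y p = complete_quotient z q" "(- 1) ^ (p + q) = e'"
    using assms(2) unfolding tail_equiv_def by blast
  have "complete_quotient x (i + p) = complete_quotient y (j + p)"
    using 1(1) by (metis complete_quotient_add)
  also have "\<dots> = complete_quotient z (q + j)"
    using 2(1) by (metis complete_quotient_add add.commute)
  finally have "complete_quotient x (i + p) = complete_quotient z (q + j)" .
  moreover have "(- 1) ^ (i + p + (q + j)) = e * e'"
    unfolding 1(2)[symmetric] 2(2)[symmetric] power_add by (simp add: mult_ac)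
  ultimately show ?thesis unfolding tail_equiv_def by blast
qed

lemma tail_equiv_add_int: "tail_equiv 1 (x + of_int q) x"
  unfolding tail_equiv_def
  by (intro exI[of _ 1]) (simp add: frac_def)

text \<open>Negation is the one generator that changes the expansion visibly:
  \<open>-[a\<^sub>0, a\<^sub>1, a\<^sub>2, \<dots>]\<close> is \<open>[-a\<^sub>0 - 1, 1, a\<^sub>1 - 1, a\<^sub>2, \<dots>]\<close>, so the common tail sits
  an odd number of places apart. If \<open>a\<^sub>1 = 1\<close>, the block \<open>1, 0, a\<^sub>2\<close> collapses to \<open>1 + a\<^sub>2\<close>, which
  moves the tail by two further places; this case is the mirror image of the other one.\<close>

lemma tail_equiv_one_minus:
  assumes "t \<notin> \<rat>" "0 < t" "t < 1"
  shows "tail_equiv (- 1) (1 - t) t"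
proof -
  have lower: "tail_equiv (- 1) (1 - s) s" if s: "s \<notin> \<rat>" "0 < s" "s < 1 / 2" for s
  proof -
    have 1: "frac (1 - s) = 1 - s" "frac s = s" using s by (auto simp: frac_eq)
    (* for \<open>s < 1/2\<close> the expansion of \<open>1 - s\<close> is \<open>[0, 1, 1/s - 1]\<close>, and that of \<open>s\<close> is \<open>[0, 1/s]\<close> *)
    have "1 / (1 - s) = of_int 1 + 1 / ((1 - s) / s)" "(1 - s) / s > 1"
      using s by (auto simp: field_simps)
    note 2 = expansion_step(2)[OF this]
    have "(1 - s) / s = 1 / s + of_int (- 1)" using s by (simp add: field_simps)
    then have 3: "frac ((1 - s) / s) = frac (1 / s)" by (simp add: frac_def)
    have "complete_quotient (1 - s) 3 = complete_quotient s 2"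
      using 1 2 3 by (simp add: numeral_3_eq_3 numeral_2_eq_2)
    then show ?thesis unfolding tail_equiv_def
      by (intro exI[of _ 3] exI[of _ 2]) simp
  qed
  have "t \<noteq> 1 / 2" using assms(1) Rats_divide[OF Rats_1 Rats_number_of] by blast
  then consider "t < 1 / 2" | "1 - t < 1 / 2" by linarith
  then show ?thesis
  proof cases
    case 1
    then show ?thesis using lower assms by blast
  next
    case 2
    moreover have "1 - t \<notin> \<rat>" using assms(1) Rats_diff_iff[of 1 t] by auto
    ultimately have "tail_equiv (- 1) (1 - (1 - t)) (1 - t)" using lower assms by force
    then show ?thesis using tail_equiv_sym by simp
  qed
qed

lemma tail_equiv_minus:
  assumes "x \<notin> \<rat>"
  shows "tail_equiv (- 1) (- x) x"
proof -
  let ?t = "frac x"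
  have "- x = (1 - ?t) + of_int (- \<lfloor>x\<rfloor> - 1)" by (simp add: frac_def)
  then have 1: "tail_equiv 1 (- x) (1 - ?t)" using tail_equiv_add_int by metis
  have 2: "tail_equiv (- 1) (1 - ?t) ?t"
    using tail_equiv_one_minus frac_irrational[OF assms] by blast
  have "x = ?t + of_int \<lfloor>x\<rfloor>" by (simp add: frac_def)
  then have 3: "tail_equiv 1 ?t x" using tail_equiv_add_int tail_equiv_sym by metis
  show ?thesis using tail_equiv_trans[OF tail_equiv_trans[OF 1 2] 3] by simp
qed

lemma tail_equiv_inverse:
  assumes "x \<notin> \<rat>"
  shows "tail_equiv (- 1) (1 / x) x"
proof -
  have large: "tail_equiv (- 1) (1 / y) y" if "y > 1" for y
  proof -
    have "frac (1 / y) = 1 / y" using that by (simp add: frac_eq)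
    then show ?thesis unfolding tail_equiv_def by (intro exI[of _ 1] exI[of _ 0]) simp
  qed
  have pos: "tail_equiv (- 1) (1 / y) y" if "y > 0" "y \<notin> \<rat>" for y
  proof (cases "y > 1")
    case False
    then have "1 / y > 1" using that by (auto simp: less_le)
    from large[OF this] show ?thesis using tail_equiv_sym by simp
  qed (use large in blast)
  show ?thesis
  proof (cases "x > 0")
    case False
    then have "- x > 0" using assms by (auto simp: less_le)
    then have "tail_equiv (- 1) (- (1 / x)) (- x)" using pos[of "- x"] assms by simp
    then have "tail_equiv 1 (- (1 / x)) x"
      using tail_equiv_trans tail_equiv_minus[OF assms] by fastforce
    moreover have "tail_equiv (- 1) (- (1 / x)) (1 / x)"
      using tail_equiv_minus[of "1 / x"] assms by simp
    ultimately show ?thesis using tail_equiv_trans tail_equiv_sym by fastforce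
  qed (use pos assms in blast)
qed

lemma linear_form_nonzero:
  fixes x :: real
  assumes "x \<notin> \<rat>" "a * d - b * c \<noteq> (0 :: int)"
  shows "of_int c * x + of_int d \<noteq> 0"
proof
  assume *: "of_int c * x + of_int d = 0"
  show False
  proof (cases "c = 0")
    case True
    then show False using * assms(2) by simp
  next
    case False
    then have "x = - of_int d / of_int c" using * by (simp add: field_simps)
    then show False using assms(1) by simp
  qed
qed

lemma moebius_irrational:
  fixes x :: real
  assumes "x \<notin> \<rat>" "a * d - b * c \<noteq> (0 :: int)"
  shows "(of_int a * x + of_int b) / (of_int c * x + of_int d) \<notin> \<rat>"
proof
  define y where "y = (of_int a * x + of_int b) / (of_int c * x + of_int d)"
  assume "(of_int a * x + of_int b) / (of_int c * x + of_int d) \<in> \<rat>"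
  then have y: "y \<in> \<rat>" by (simp add: y_def)
  have "of_int a * x + of_int b = y * (of_int c * x + of_int d)"
    unfolding y_def using linear_form_nonzero[OF assms] by simp
  then have *: "(of_int a - y * of_int c) * x = y * of_int d - of_int b"
    by (simp add: algebra_simps)
  show False
  proof (cases "of_int a - y * of_int c = 0")
    case True
    with * have "of_int b = y * of_int d" "of_int a = y * of_int c" by auto
    then have "real_of_int (a * d - b * c) = 0"
      by (simp add: algebra_simps)
    then show False using assms(2) by linarith
  next
    case False
    with * have "x = (y * of_int d - of_int b) / (of_int a - y * of_int c)"
      by (simp only: nonzero_eq_divide_eq mult.commute not_False_eq_True)
    also have "\<dots> \<in> \<rat>"
      by (intro Rats_divide Rats_diff Rats_mult y Rats_of_int)
    finally show False using assms(1) by contradiction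
  qed
qed

text \<open>The parity of the shift between the common tails is the determinant: the Euclidean
  algorithm on the first column writes an integral matrix as a product of integer translations,
  inversions and negations, and each inversion and negation contributes a sign and an odd
  shift.\<close>

theorem tail_equiv_moebius:
  fixes x :: real
  assumes "x \<notin> \<rat>" "\<bar>a * d - b * c\<bar> = (1 :: int)"
  shows "tail_equiv (a * d - b * c) ((of_int a * x + of_int b) / (of_int c * x + of_int d)) x"
  using assms(2)
proof (induction "nat \<bar>c\<bar>" arbitrary: a b c d rule: less_induct)
  case less
  show ?case
  proof (cases "c = 0")
    case True
    then have "\<bar>a * d\<bar> = 1" using less.prems by simp
    then consider "a = 1" "d = 1" | "a = - 1" "d = - 1" | "a = 1" "d = - 1" | "a = - 1" "d = 1"
      by (metis abs_eq_iff' abs_zmult_eq_1 mult.commute zmult_eq_1_iff abs_1)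
    then show ?thesis
    proof cases
      case 1
      then show ?thesis using True tail_equiv_add_int[of x b] by simp
    next
      case 2
      then show ?thesis using True tail_equiv_add_int[of x "- b"] by simp
    next
      case 3
      then show ?thesis
        using True tail_equiv_trans[OF tail_equiv_add_int[of "- x" "- b"] tail_equiv_minus]
          assms(1) by simp
    next
      case 4
      then show ?thesis
        using True tail_equiv_trans[OF tail_equiv_add_int[of "- x" b] tail_equiv_minus]
          assms(1) by simp
    qed
  next
    case False
    (* the number is \<open>q + 1/y\<close>, where the matrix of \<open>y\<close> has the smaller entry \<open>r = a mod c\<close>
       below the diagonal and determinant \<open>-(ad - bc)\<close> *)
    define q where "q = a div c"
    define r where "r = a mod c"
    define b' where "b' = b - q * d"
    have a: "a = q * c + r" by (simp add: q_def r_def)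
    have det: "c * b' - d * r = - (a * d - b * c)"
      unfolding a b'_def by (simp add: algebra_simps)
    let ?y = "(of_int c * x + of_int d) / (of_int r * x + of_int b') :: real"
    have "nat \<bar>r\<bar> < nat \<bar>c\<bar>" using False by (simp add: r_def abs_mod_less)
    then have 1: "tail_equiv (- (a * d - b * c)) ?y x"
      using less.hyps[of r c b' d] less.prems unfolding det by simp
    have nz: "a * d - b * c \<noteq> 0" "c * b' - d * r \<noteq> 0" using less.prems det by auto
    have 2: "tail_equiv (- 1) (1 / ?y) ?y"
      using tail_equiv_inverse moebius_irrational[OF assms(1) nz(2)] by blast
    have "of_int c * x + of_int d \<noteq> 0" using linear_form_nonzero[OF assms(1) nz(1)] .
    then have "(of_int a * x + of_int b) / (of_int c * x + of_int d) = 1 / ?y + of_int q"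
      unfolding a b'_def by (simp add: field_simps)
    then have "tail_equiv 1 ((of_int a * x + of_int b) / (of_int c * x + of_int d)) (1 / ?y)"
      using tail_equiv_add_int by metis
    from tail_equiv_trans[OF tail_equiv_trans[OF this 2] 1] show ?thesis by simp
  qed
qed

section \<open>Quadratic forms and the twisted action of integral matrices\<close>

fun discriminant :: "form \<Rightarrow> int" where
  "discriminant (m, n, k) = k\<^sup>2 - 4 * m * n"

definition nonsquare_form :: "form \<Rightarrow> bool" where
  "nonsquare_form f \<longleftrightarrow> discriminant f > 0 \<and> \<not> is_square (discriminant f)"

lemma sqrt_nonsquare_irrational:
  assumes "D \<ge> 0" "\<not> is_square (D :: int)"
  shows "sqrt (of_int D) \<notin> \<rat>"
proof
  assume "sqrt (of_int D) \<in> \<rat>"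
  then obtain p q :: nat where q: "q \<noteq> 0" and pq: "\<bar>sqrt (of_int D)\<bar> = p / q"
    and cop: "coprime p q"
    by (rule Rats_abs_nat_div_natE)
  have "real p = sqrt (of_int D) * real q"
    using pq q assms(1) by (simp add: field_simps)
  then have "(real p)\<^sup>2 = of_int D * (real q)\<^sup>2"
    using assms(1) by (simp add: power_mult_distrib)
  then have "real_of_int ((int p)\<^sup>2) = real_of_int (D * (int q)\<^sup>2)" by simp
  then have eq: "(int p)\<^sup>2 = D * (int q)\<^sup>2" by (simp only: of_int_eq_iff)
  have "coprime ((int p)\<^sup>2) ((int q)\<^sup>2)" using cop by simp
  moreover have "(int q)\<^sup>2 dvd (int p)\<^sup>2" using eq by simp
  ultimately have "is_unit ((int q)\<^sup>2)"
    by (metis coprime_absorb_right)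
  then have "(int q)\<^sup>2 = 1" by simp
  then have "D = (int p)\<^sup>2" using eq by simp
  then show False using assms(2) by blast
qed

lemma sqrt_discriminant_irrational:
  "nonsquare_form f \<Longrightarrow> sqrt (of_int (discriminant f)) \<notin> \<rat>"
  unfolding nonsquare_form_def by (intro sqrt_nonsquare_irrational) auto

lemma sqrt_discriminant_squared:
  "nonsquare_form (m, n, k) \<Longrightarrow> (sqrt (of_int (discriminant (m, n, k))))\<^sup>2
     = of_int k ^ 2 - 4 * of_int m * of_int n"
  unfolding nonsquare_form_def by (simp del: discriminant.simps) simp

lemma nonsquare_form_nonzero:
  assumes "nonsquare_form (m, n, k)"
  shows "m \<noteq> 0" "n \<noteq> 0"
  using assms unfolding nonsquare_form_def by auto

lemma xi_plus_eq:
  "xi_plus (m, n, k) = (sqrt (of_int (discriminant (m, n, k))) - of_int k) / (2 * of_int m)"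
  by simp

lemma xi_plus_irrational:
  assumes "nonsquare_form f"
  shows "xi_plus f \<notin> \<rat>"
proof
  obtain m n k where f: "f = (m, n, k)" by (cases f)
  assume "xi_plus f \<in> \<rat>"
  then have "xi_plus f * (2 * of_int m) + of_int k \<in> \<rat>" by simp
  also have "xi_plus f * (2 * of_int m) + of_int k = sqrt (of_int (discriminant f))"
    unfolding f xi_plus_eq using nonsquare_form_nonzero assms f by simp
  finally show False using sqrt_discriminant_irrational[OF assms] by contradiction
qed

text \<open>As \<open>\<surd>D\<close> is irrational, the rational and irrational parts of the root give back the
  coefficients. This is what turns equalities between roots into equalities between forms.\<close>

lemma xi_plus_inject:
  assumes "nonsquare_form f" "discriminant f = discriminant g" "xi_plus f = xi_plus g"
  shows "f = g"
proof -
  obtain m n k where f: "f = (m, n, k)" by (cases f)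
  obtain M N K where g: "g = (M, N, K)" by (cases g)
  define s where "s = sqrt (of_int (discriminant f))"
  have s: "s \<notin> \<rat>" using sqrt_discriminant_irrational[OF assms(1)] by (simp add: s_def)
  have nz: "m \<noteq> 0" "M \<noteq> 0"
    using nonsquare_form_nonzero assms f g unfolding nonsquare_form_def by metis+
  have "(s - of_int k) / (2 * of_int m) = (s - of_int K) / (2 * of_int M)"
    using assms(2,3) unfolding s_def f g xi_plus_eq by simp
  then have eq: "s * of_int (M - m) = of_int (k * M - K * m)"
    using nz by (simp add: field_simps)
  have "M = m"
  proof (rule ccontr)
    assume "M \<noteq> m"
    then have "s = of_int (k * M - K * m) / of_int (M - m)"
      using eq by (simp add: field_simps)
    then show False using s by (metis Rats_divide Rats_of_int)
  qed
  with eq nz have "k = K" by simp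
  with \<open>M = m\<close> assms(2) nz show ?thesis by (simp add: f g)
qed

text \<open>The form is multiplied by the determinant in order that the distinguished root
  \<^term>\<open>xi_plus\<close> of the one form is carried to that of the other: a substitution of
  determinant \<open>-1\<close> alone would interchange the two roots.\<close>

definition gl_equiv :: "int \<Rightarrow> form \<Rightarrow> form \<Rightarrow> bool" where
  "gl_equiv e f g \<longleftrightarrow> (\<exists>a b c d. a * d - b * c = e \<and> \<bar>e\<bar> = 1 \<and>
     (\<forall>x y. form_eval g x y = e * form_eval f (a * x + b * y) (c * x + d * y)))"

lemma form_eval_eqD:
  assumes "\<forall>x y. form_eval (m, n, k) x y = form_eval (m', n', k') x y"
  shows "(m, n, k) = (m', n', k')"
  using assms[rule_format, of 1 0] assms[rule_format, of 0 1] assms[rule_format, of 1 1]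
  by simp

lemma gl_equiv_explicit:
  "gl_equiv e (m, n, k) g \<longleftrightarrow> (\<exists>a b c d. a * d - b * c = e \<and> \<bar>e\<bar> = 1 \<and>
     g = (e * (m * a\<^sup>2 + n * c\<^sup>2 + k * a * c), e * (m * b\<^sup>2 + n * d\<^sup>2 + k * b * d),
          e * (2 * m * a * b + 2 * n * c * d + k * (a * d + b * c))))"
proof -
  have "(\<forall>x y. form_eval g x y = e * form_eval (m, n, k) (a * x + b * y) (c * x + d * y))
    \<longleftrightarrow> g = (e * (m * a\<^sup>2 + n * c\<^sup>2 + k * a * c), e * (m * b\<^sup>2 + n * d\<^sup>2 + k * b * d),
          e * (2 * m * a * b + 2 * n * c * d + k * (a * d + b * c)))" (is "?L \<longleftrightarrow> g = ?R")
    for a b c d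
  proof -
    have R: "e * form_eval (m, n, k) (a * x + b * y) (c * x + d * y) = form_eval ?R x y"
      for x y
      by (simp add: power2_eq_square algebra_simps)
    show ?thesis unfolding R using form_eval_eqD by (cases g) blast
  qed
  then show ?thesis unfolding gl_equiv_def by simp
qed

lemma gl_equiv_unit: "gl_equiv e f g \<Longrightarrow> e * e = 1"
  unfolding gl_equiv_def by (auto simp: abs_if split: if_splits)

lemma gl_equiv_refl: "gl_equiv 1 f f"
  unfolding gl_equiv_def by (intro exI[of _ 1] exI[of _ 0]) auto

lemma gl_equiv_sym:
  assumes "gl_equiv e f g"
  shows "gl_equiv e g f"
proof -
  from assms obtain a b c d where det: "a * d - b * c = e" "\<bar>e\<bar> = 1"
    and g: "\<And>x y. form_eval g x y = e * form_eval f (a * x + b * y) (c * x + d * y)"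
    unfolding gl_equiv_def by blast
  have e: "e * e = 1" using gl_equiv_unit[OF assms] .
  have 1: "a * (e * d * x + (- e * b) * y) + b * ((- e * c) * x + e * a * y) = e * (a * d - b * c) * x"
    "c * (e * d * x + (- e * b) * y) + d * ((- e * c) * x + e * a * y) = e * (a * d - b * c) * y"
    for x y by (simp_all add: algebra_simps)
  have 2: "form_eval f x y = e * form_eval g (e * d * x + (- e * b) * y) ((- e * c) * x + e * a * y)"
    for x y
    unfolding g 1 unfolding det(1) e by (simp add: e mult.assoc[symmetric])
  have "(e * d) * (e * a) - (- e * b) * (- e * c) = (e * e) * (a * d - b * c)"
    by (simp add: algebra_simps)
  also have "\<dots> = e" by (simp only: e det(1))
  finally show ?thesis unfolding gl_equiv_def using det(2) 2 by blast
qed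

lemma gl_equiv_trans:
  assumes "gl_equiv e f g" "gl_equiv e' g h"
  shows "gl_equiv (e * e') f h"
proof -
  from assms(1) obtain a b c d where det: "a * d - b * c = e" "\<bar>e\<bar> = 1"
    and g: "\<And>x y. form_eval g x y = e * form_eval f (a * x + b * y) (c * x + d * y)"
    unfolding gl_equiv_def by blast
  from assms(2) obtain a' b' c' d' where det': "a' * d' - b' * c' = e'" "\<bar>e'\<bar> = 1"
    and h: "\<And>x y. form_eval h x y = e' * form_eval g (a' * x + b' * y) (c' * x + d' * y)"
    unfolding gl_equiv_def by blast
  have 1: "a * (a' * x + b' * y) + b * (c' * x + d' * y)
      = (a * a' + b * c') * x + (a * b' + b * d') * y"
    "c * (a' * x + b' * y) + d * (c' * x + d' * y)
      = (c * a' + d * c') * x + (c * b' + d * d') * y" for x y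
    by (simp_all add: algebra_simps)
  have 2: "form_eval h x y = e * e' * form_eval f
      ((a * a' + b * c') * x + (a * b' + b * d') * y)
      ((c * a' + d * c') * x + (c * b' + d * d') * y)" for x y
    unfolding h g 1 by (simp add: mult_ac)
  have 3: "(a * a' + b * c') * (c * b' + d * d') - (a * b' + b * d') * (c * a' + d * c')
      = e * e'"
    unfolding det(1)[symmetric] det'(1)[symmetric] by (simp add: algebra_simps)
  have "\<bar>e * e'\<bar> = 1" using det(2) det'(2) by (simp add: abs_mult)
  with 2 3 show ?thesis unfolding gl_equiv_def by blast
qed

lemma gl_equiv_discriminant:
  assumes "gl_equiv e f g"
  shows "discriminant g = discriminant f"
proof -
  obtain m n k where f: "f = (m, n, k)" by (cases f)
  from assms obtain a b c d where det: "a * d - b * c = e"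
    and g: "g = (e * (m * a\<^sup>2 + n * c\<^sup>2 + k * a * c), e * (m * b\<^sup>2 + n * d\<^sup>2 + k * b * d),
          e * (2 * m * a * b + 2 * n * c * d + k * (a * d + b * c)))"
    unfolding f gl_equiv_explicit by blast
  have "discriminant g = (e * e) * (a * d - b * c)\<^sup>2 * discriminant f"
    unfolding g f by (simp add: power2_eq_square algebra_simps)
  then show ?thesis using gl_equiv_unit[OF assms] det by (simp add: power2_eq_square)
qed

lemma gl_equiv_nonsquare:
  "gl_equiv e f g \<Longrightarrow> nonsquare_form f \<Longrightarrow> nonsquare_form g"
  unfolding nonsquare_form_def using gl_equiv_discriminant by simp

text \<open>Clearing denominators in the claim leaves a polynomial in \<open>s = \<surd>D\<close> with \<open>s\<^sup>2 = D\<close>; its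
  coefficient at \<open>s\<close> and its constant term vanish separately, because \<open>e (ad - bc) = 1\<close>.\<close>

lemma xi_plus_moebius:
  assumes "nonsquare_form (m, n, k)" "a * d - b * c = e" "\<bar>e\<bar> = 1"
    and "g = (e * (m * a\<^sup>2 + n * c\<^sup>2 + k * a * c), e * (m * b\<^sup>2 + n * d\<^sup>2 + k * b * d),
          e * (2 * m * a * b + 2 * n * c * d + k * (a * d + b * c)))"
  shows "xi_plus (m, n, k)
    = (of_int a * xi_plus g + of_int b) / (of_int c * xi_plus g + of_int d)"
proof -
  obtain M N K where g: "g = (M, N, K)" by (cases g)
  have eq: "gl_equiv e (m, n, k) g"
    unfolding gl_equiv_explicit using assms(2-4) by blast
  note ns = gl_equiv_nonsquare[OF eq assms(1)]
  have e: "e * (a * d - b * c) = 1" using assms(2) gl_equiv_unit[OF eq] by simp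
  have M: "M = e * (m * a\<^sup>2 + n * c\<^sup>2 + k * a * c)"
    and K: "K = e * (2 * m * a * b + 2 * n * c * d + k * (a * d + b * c))"
    using assms(4) g by auto
  define s where "s = sqrt (of_int (discriminant (m, n, k)))"
  define x where "x = xi_plus (m, n, k)"
  define y where "y = xi_plus g"
  have nz: "m \<noteq> 0" "M \<noteq> 0" using nonsquare_form_nonzero assms(1) ns g by metis+
  have x: "2 * of_int m * x = s - of_int k"
    unfolding x_def xi_plus_eq s_def using nz by simp
  have y: "2 * of_int M * y = s - of_int K"
    unfolding y_def g xi_plus_eq s_def
    using nz gl_equiv_discriminant[OF eq] by (simp add: g)
  have s2: "s * s = of_int (k\<^sup>2 - 4 * m * n)"
    using sqrt_discriminant_squared[OF assms(1)] by (simp add: s_def power2_eq_square)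
  have "- c * K + 2 * d * M = e * (a * d - b * c) * (2 * m * a + k * c)"
    unfolding M K by (simp add: power2_eq_square algebra_simps)
  then have "- c * K + 2 * d * M = 2 * m * a + k * c" by (simp only: e mult_1_left)
  then have I1: "real_of_int (- c * K + 2 * d * M) = of_int (2 * m * a + k * c)"
    by (simp only:)
  have "K * (k * c + 2 * m * a) - 2 * M * (k * d + 2 * m * b)
      = - c * (k\<^sup>2 - 4 * m * n) * (e * (a * d - b * c))"
    unfolding M K by (simp add: power2_eq_square algebra_simps)
  then have "K * (k * c + 2 * m * a) - 2 * M * (k * d + 2 * m * b) = - c * (k\<^sup>2 - 4 * m * n)"
    by (simp only: e mult_1_right)
  then have I2: "real_of_int (K * (k * c + 2 * m * a) - 2 * M * (k * d + 2 * m * b))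
      = of_int (- c * (k\<^sup>2 - 4 * m * n))"
    by (simp only:)
  have "(2 * of_int m * x) * (of_int c * (2 * of_int M * y) + 2 * of_int M * of_int d)
      - 2 * of_int m * (of_int a * (2 * of_int M * y) + 2 * of_int M * of_int b)
    = of_int c * (s * s) + s * (of_int (- c * K + 2 * d * M) - of_int (2 * m * a + k * c))
      + of_int (K * (k * c + 2 * m * a) - 2 * M * (k * d + 2 * m * b))"
    unfolding x y by (simp add: algebra_simps)
  also have "\<dots> = 0" unfolding I1 I2 s2 by simp
  finally have "(4 * of_int m * of_int M)
      * (x * (of_int c * y + of_int d) - (of_int a * y + of_int b)) = 0"
    by (simp add: algebra_simps)
  then have "x * (of_int c * y + of_int d) = of_int a * y + of_int b"
    using nz by simp
  moreover have "of_int c * y + of_int d \<noteq> 0"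
    unfolding y_def
    by (rule linear_form_nonzero[OF xi_plus_irrational[OF ns], of a d b]) (use e in auto)
  ultimately show ?thesis unfolding x_def y_def by (simp add: field_simps)
qed

text \<open>One step of the continued fraction algorithm, performed on forms: the substitution
  \<open>(x, y) \<mapsto> (a x + y, x)\<close>, where \<open>a\<close> is the integer part of the root. It has determinant \<open>-1\<close>, hence
  the minus signs.\<close>

fun cf_step :: "form \<Rightarrow> form" where
  "cf_step (m, n, k) = (let a = \<lfloor>xi_plus (m, n, k)\<rfloor> in
     (- (m * a\<^sup>2 + n + k * a), - m, - (2 * m * a + k)))"

declare cf_step.simps [simp del] xi_plus.simps [simp del]

lemma gl_equiv_cf_step: "gl_equiv (- 1) f (cf_step f)"
proof -
  obtain m n k where f: "f = (m, n, k)" by (cases f)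
  show ?thesis unfolding f gl_equiv_explicit
    by (intro exI[of _ "\<lfloor>xi_plus (m, n, k)\<rfloor>"] exI[of _ 1] exI[of _ 0])
      (simp add: cf_step.simps Let_def)
qed

lemma xi_plus_cf_step:
  assumes "nonsquare_form f"
  shows "xi_plus (cf_step f) = 1 / frac (xi_plus f)"
proof -
  obtain m n k where f: "f = (m, n, k)" by (cases f)
  let ?a = "\<lfloor>xi_plus f\<rfloor>"
  have "xi_plus (cf_step f) \<noteq> 0"
    using xi_plus_irrational[OF gl_equiv_nonsquare[OF gl_equiv_cf_step assms]] by auto
  moreover have "xi_plus f = (of_int ?a * xi_plus (cf_step f) + of_int 1)
      / (of_int 1 * xi_plus (cf_step f) + of_int 0)"
    unfolding f
    by (rule xi_plus_moebius[where e = "- 1"]) (use assms f in \<open>auto simp: cf_step.simps Let_def\<close>)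
  ultimately have "frac (xi_plus f) = 1 / xi_plus (cf_step f)"
    by (simp add: frac_def field_simps)
  then show ?thesis by simp
qed

definition cf_form :: "form \<Rightarrow> nat \<Rightarrow> form" where
  "cf_form f i = (cf_step ^^ i) f"

lemma cf_form_simps [simp]: "cf_form f 0 = f" "cf_form f (Suc i) = cf_step (cf_form f i)"
  by (simp_all add: cf_form_def)

lemma cf_form_add: "cf_form (cf_form f i) j = cf_form f (i + j)"
  by (induction j) simp_all

lemma gl_equiv_cf_form: "gl_equiv ((- 1) ^ i) f (cf_form f i)"
proof (induction i)
  case 0
  then show ?case by (simp add: gl_equiv_refl)
next
  case (Suc i)
  from gl_equiv_trans[OF this gl_equiv_cf_step] show ?case by (simp add: mult.commute)
qed

lemma nonsquare_cf_form: "nonsquare_form f \<Longrightarrow> nonsquare_form (cf_form f i)"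
  using gl_equiv_nonsquare gl_equiv_cf_form by blast

lemma xi_plus_cf_form:
  assumes "nonsquare_form f"
  shows "xi_plus (cf_form f i) = complete_quotient (xi_plus f) i"
  by (induction i) (simp_all add: xi_plus_cf_step nonsquare_cf_form assms)

text \<open>Forms are thus classified by the tails of their continued fractions. From left to right this
  is Serret's theorem. From right to left, equal complete quotients belong to equal forms, and the
  \<open>i\<close>-th form is reached by \<open>i\<close> substitutions of determinant \<open>-1\<close>.\<close>

theorem gl_equiv_iff_tail_equiv:
  assumes "nonsquare_form f" "discriminant f = discriminant g"
  shows "gl_equiv e f g \<longleftrightarrow> tail_equiv e (xi_plus f) (xi_plus g)"
proof
  assume L: "gl_equiv e f g"
  obtain m n k where f: "f = (m, n, k)" by (cases f)
  from L obtain a b c d where det: "a * d - b * c = e" "\<bar>e\<bar> = 1"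
    and g: "g = (e * (m * a\<^sup>2 + n * c\<^sup>2 + k * a * c), e * (m * b\<^sup>2 + n * d\<^sup>2 + k * b * d),
          e * (2 * m * a * b + 2 * n * c * d + k * (a * d + b * c)))"
    unfolding f gl_equiv_explicit by blast
  have "xi_plus f = (of_int a * xi_plus g + of_int b) / (of_int c * xi_plus g + of_int d)"
    unfolding f by (rule xi_plus_moebius[OF assms(1)[unfolded f] det g])
  then show "tail_equiv e (xi_plus f) (xi_plus g)"
    using tail_equiv_moebius[OF xi_plus_irrational[OF gl_equiv_nonsquare[OF L assms(1)]]]
      det by metis
next
  assume "tail_equiv e (xi_plus f) (xi_plus g)"
  then obtain i j where ij: "complete_quotient (xi_plus f) i = complete_quotient (xi_plus g) j"
    and e: "(- 1) ^ (i + j) = e"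
    unfolding tail_equiv_def by blast
  have g: "nonsquare_form g" using assms unfolding nonsquare_form_def by simp
  have "cf_form f i = cf_form g j"
    using ij xi_plus_cf_form assms g gl_equiv_discriminant[OF gl_equiv_cf_form]
    by (intro xi_plus_inject nonsquare_cf_form) auto
  then have "gl_equiv ((- 1) ^ i * (- 1) ^ j) f g"
    using gl_equiv_trans gl_equiv_sym gl_equiv_cf_form by metis
  then show "gl_equiv e f g" using e by (simp add: power_add)
qed

section \<open>The three symmetries in terms of the twisted action\<close>

lemma form_class_eq: "form_class f = {g. gl_equiv 1 f g}"
  unfolding form_class_def gl_equiv_def by simp

lemma discriminant_adjoint [simp]: "discriminant (adjoint_form f) = discriminant f"
  by (cases f) simp

lemma nonsquare_adjoint [simp]: "nonsquare_form (adjoint_form f) \<longleftrightarrow> nonsquare_form f"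
  by (simp add: nonsquare_form_def)

lemma adjoint_adjoint [simp]: "adjoint_form (adjoint_form f) = f"
  by (cases f) simp

text \<open>The adjoint of \<open>f\<close> is \<open>-f(y, -x)\<close>, so passing to adjoints conjugates substitutions by a
  rotation, which preserves determinants.\<close>

lemma gl_equiv_adjoint:
  assumes "gl_equiv e f g"
  shows "gl_equiv e (adjoint_form f) (adjoint_form g)"
proof -
  obtain m n k where f: "f = (m, n, k)" by (cases f)
  from assms obtain a b c d where det: "a * d - b * c = e" "\<bar>e\<bar> = 1"
    and g: "g = (e * (m * a\<^sup>2 + n * c\<^sup>2 + k * a * c), e * (m * b\<^sup>2 + n * d\<^sup>2 + k * b * d),
          e * (2 * m * a * b + 2 * n * c * d + k * (a * d + b * c)))"
    unfolding f gl_equiv_explicit by blast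
  show ?thesis unfolding f adjoint_form.simps gl_equiv_explicit
    by (rule exI[of _ d], rule exI[of _ "- c"], rule exI[of _ "- b"], rule exI[of _ a])
      (use det g in \<open>auto simp: algebra_simps\<close>)
qed

text \<open>The antipodal form is \<open>-f(y, x)\<close>, which the twisted action reaches with determinant \<open>-1\<close>; the
  conjugate is the antipodal of the adjoint.\<close>

lemma gl_equiv_antipodal: "gl_equiv (- 1) f (antipodal_form f)"
proof -
  obtain m n k where f: "f = (m, n, k)" by (cases f)
  show ?thesis unfolding f gl_equiv_explicit
    by (intro exI[of _ 0] exI[of _ 1]) simp
qed

lemma gl_equiv_conjugate: "gl_equiv (- 1) (adjoint_form f) (conjugate_form f)"
proof -
  have "conjugate_form f = antipodal_form (adjoint_form f)" by (cases f) simp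
  then show ?thesis using gl_equiv_antipodal by simp
qed

text \<open>Each of the three involutions \<open>\<sigma>\<close> is, up to a substitution of determinant \<open>e\<close>, either the
  identity or the adjoint \<open>\<tau>\<close>. Since \<open>\<tau>\<close> acts on classes, invariance of the class under \<open>\<sigma>\<close> is a
  relation between \<open>f\<close> and \<open>\<tau> f\<close> with that determinant.\<close>

lemma invariant_under_iff:
  assumes \<tau>: "\<And>g h. gl_equiv 1 g h \<Longrightarrow> gl_equiv 1 (\<tau> g) (\<tau> h)"
    and \<sigma>: "\<And>g. gl_equiv e (\<tau> g) (\<sigma> g)" "\<And>g. \<sigma> (\<sigma> g) = g"
  shows "invariant_under \<sigma> (form_class f) \<longleftrightarrow> gl_equiv e f (\<tau> f)"
proof
  assume inv: "invariant_under \<sigma> (form_class f)"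
  have "f \<in> form_class f" by (simp add: form_class_eq gl_equiv_refl)
  then have "\<sigma> f \<in> form_class f" using inv unfolding invariant_under_def by blast
  then have "gl_equiv 1 f (\<sigma> f)" by (simp add: form_class_eq)
  from gl_equiv_trans[OF this gl_equiv_sym[OF \<sigma>(1)]] show "gl_equiv e f (\<tau> f)" by simp
next
  assume L: "gl_equiv e f (\<tau> f)"
  have sub: "\<sigma> g \<in> form_class f" if "g \<in> form_class f" for g
  proof -
    have "gl_equiv 1 f g" using that by (simp add: form_class_eq)
    from gl_equiv_trans[OF gl_equiv_trans[OF L \<tau>[OF this]] \<sigma>(1)] show ?thesis
      using gl_equiv_unit[OF L] by (simp add: form_class_eq)
  qed
  moreover have "g \<in> \<sigma> ` form_class f" if "g \<in> form_class f" for g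
    using imageI[OF sub[OF that], of \<sigma>] by (simp only: \<sigma>(2))
  ultimately show "invariant_under \<sigma> (form_class f)"
    unfolding invariant_under_def by blast
qed

lemma invariant_under_adjoint_iff:
  "invariant_under adjoint_form (form_class f) \<longleftrightarrow> gl_equiv 1 f (adjoint_form f)"
  by (rule invariant_under_iff) (auto intro: gl_equiv_adjoint gl_equiv_refl)

lemma invariant_under_conjugate_iff:
  "invariant_under conjugate_form (form_class f) \<longleftrightarrow> gl_equiv (- 1) f (adjoint_form f)"
  by (rule invariant_under_iff) (auto intro: gl_equiv_adjoint gl_equiv_conjugate)

lemma invariant_under_antipodal_iff:
  "invariant_under antipodal_form (form_class f) \<longleftrightarrow> gl_equiv (- 1) f f"
  by (rule invariant_under_iff[where \<tau> = "\<lambda>g. g"]) (auto intro: gl_equiv_antipodal)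

text \<open>The condition on the conjugation follows from the one on the antipodal involution: a class
  invariant under the adjoint and the conjugation is invariant under their composition, the antipodal involution.\<close>

lemma m_plus_n_symmetric_iff:
  "m_plus_n_symmetric (form_class f)
     \<longleftrightarrow> gl_equiv 1 f (adjoint_form f) \<and> \<not> gl_equiv (- 1) f f"
proof -
  have "gl_equiv (- 1) f f"
    if "gl_equiv 1 f (adjoint_form f)" "gl_equiv (- 1) f (adjoint_form f)"
    using gl_equiv_trans[OF that(1) gl_equiv_sym[OF that(2)]] by simp
  then show ?thesis
    unfolding m_plus_n_symmetric_def invariant_under_adjoint_iff invariant_under_conjugate_iff
      invariant_under_antipodal_iff by blast
qed

section \<open>Reduced forms and Lagrange's theorem\<close>

text \<open>The root of the adjoint form is \<open>-1 / \<xi>\<^sup>-\<close>, where \<open>\<xi>\<^sup>-\<close> is the second root of \<open>f\<close>. So the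
  condition is the classical one that \<open>\<xi>\<^sup>+ > 1\<close> and \<open>-1 < \<xi>\<^sup>- < 0\<close>, and it is visibly
  symmetric under passing to the adjoint.\<close>

definition reduced :: "form \<Rightarrow> bool" where
  "reduced f \<longleftrightarrow> xi_plus f > 1 \<and> xi_plus (adjoint_form f) > 1"

lemma xi_plus_adjoint_cf_step:
  assumes "nonsquare_form f"
  shows "xi_plus (adjoint_form (cf_step f))
    = of_int \<lfloor>xi_plus f\<rfloor> + 1 / xi_plus (adjoint_form f)"
proof -
  obtain m n k where f: "f = (m, n, k)" by (cases f)
  let ?X = "xi_plus (adjoint_form (cf_step f))"
  let ?a = "\<lfloor>xi_plus f\<rfloor>"
  have "xi_plus (- n, - m, k) = (of_int 0 * ?X + of_int (- 1)) / (of_int (- 1) * ?X + of_int ?a)"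
    by (rule xi_plus_moebius[where e = "- 1"])
      (use assms nonsquare_adjoint[of f] f
        in \<open>auto simp: cf_step.simps Let_def algebra_simps\<close>)
  moreover have "?X \<notin> \<rat>"
    using xi_plus_irrational gl_equiv_nonsquare[OF gl_equiv_cf_step] assms by simp
  then have "?X \<noteq> of_int ?a" by (metis Rats_of_int)
  moreover have "xi_plus (- n, - m, k) \<noteq> 0"
    using xi_plus_irrational[of "adjoint_form f"] assms
    unfolding nonsquare_adjoint by (auto simp: f)
  ultimately have "1 / xi_plus (- n, - m, k) = ?X - of_int ?a"
    by (simp add: field_simps)
  then show ?thesis by (simp add: f)
qed

lemma xi_plus_mult_adjoint:
  assumes "nonsquare_form (m, n, k)"
  shows "xi_plus (m, n, k) * xi_plus (adjoint_form (m, n, k)) * of_int (- (4 * m * n))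
    = (sqrt (of_int (discriminant (m, n, k))) - of_int k)\<^sup>2"
proof -
  have "discriminant (- n, - m, k) = discriminant (m, n, k)" by simp
  then show ?thesis
    using nonsquare_form_nonzero[OF assms]
    by (simp add: xi_plus_eq field_simps power2_eq_square del: discriminant.simps)
qed

lemma sqrt_discriminant_neq:
  assumes "nonsquare_form f"
  shows "sqrt (of_int (discriminant f)) \<noteq> of_int k"
  using sqrt_discriminant_irrational[OF assms] by (metis Rats_of_int)

lemma xi_plus_neq_conjugate:
  assumes "nonsquare_form f"
  shows "xi_plus f \<noteq> - 1 / xi_plus (adjoint_form f)"
proof
  obtain m n k where f: "f = (m, n, k)" by (cases f)
  define s where "s = sqrt (of_int (discriminant f))"
  assume "xi_plus f = - 1 / xi_plus (adjoint_form f)"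
  moreover have "xi_plus (adjoint_form f) \<noteq> 0"
    using xi_plus_irrational[of "adjoint_form f"] assms by auto
  ultimately have "xi_plus f * xi_plus (adjoint_form f) = - 1" by simp
  then have "(s - of_int k)\<^sup>2 = of_int (4 * m * n)"
    using xi_plus_mult_adjoint assms unfolding f s_def by fastforce
  moreover have "s\<^sup>2 = of_int k ^ 2 - 4 * of_int m * of_int n"
    unfolding s_def using sqrt_discriminant_squared assms f by blast
  moreover have "2 * s * (s - of_int k) = ((s - of_int k)\<^sup>2 - of_int (4 * m * n))
      + (s\<^sup>2 - (of_int k ^ 2 - 4 * of_int m * of_int n))"
    by (simp add: power2_eq_square algebra_simps)
  ultimately have "2 * s * (s - of_int k) = 0" by simp
  moreover have "s \<noteq> of_int 0" "s \<noteq> of_int k"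
    unfolding s_def using sqrt_discriminant_neq[OF assms] by blast+
  ultimately show False by simp
qed

text \<open>The roots of a reduced form have opposite signs, so \<open>mn < 0\<close> and \<open>D = k\<^sup>2 + 4 \<bar>mn\<bar>\<close> bounds all
  coefficients.\<close>

lemma finite_reduced_forms:
  "finite {f. nonsquare_form f \<and> discriminant f = D \<and> reduced f}"
proof (rule finite_subset)
  show "finite ({- D..D} \<times> {- D..D} \<times> {- D..D})" by simp
  show "{f. nonsquare_form f \<and> discriminant f = D \<and> reduced f}
    \<subseteq> {- D..D} \<times> {- D..D} \<times> {- D..D}"
  proof
    fix f assume "f \<in> {f. nonsquare_form f \<and> discriminant f = D \<and> reduced f}"
    then have f: "nonsquare_form f" "discriminant f = D" "reduced f" by auto
    obtain m n k where fmnk: "f = (m, n, k)" by (cases f)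
    have "0 < xi_plus f * xi_plus (adjoint_form f)"
      using f(3) unfolding reduced_def by simp
    moreover have "0 < xi_plus f * xi_plus (adjoint_form f) * of_int (- (4 * m * n))"
      using xi_plus_mult_adjoint f(1) sqrt_discriminant_neq[OF f(1), of k] unfolding fmnk
      by (metis zero_less_power2 right_minus_eq)
    ultimately have "0 < real_of_int (- (4 * m * n))"
      by (rule zero_less_mult_pos[rotated])
    then have neg: "m * n < 0" by (simp only: of_int_0_less_iff)
    have D: "k * k + 4 * \<bar>m\<bar> * \<bar>n\<bar> = D"
      using f(2) neg by (simp add: fmnk power2_eq_square abs_mult[symmetric] mult.assoc)
    have nz: "1 \<le> \<bar>m\<bar>" "1 \<le> \<bar>n\<bar>"
      using neg by (cases "m = 0"; cases "n = 0"; simp; linarith)+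
    have "\<bar>k\<bar> \<le> k * k"
      using mult_left_mono[of 1 "\<bar>k\<bar>" "\<bar>k\<bar>"] by (cases "k = 0") auto
    moreover have "\<bar>m\<bar> * 1 \<le> \<bar>m\<bar> * \<bar>n\<bar>" "1 * \<bar>n\<bar> \<le> \<bar>m\<bar> * \<bar>n\<bar>"
      using nz by (intro mult_left_mono mult_right_mono; simp)+
    ultimately have "\<bar>m\<bar> \<le> D" "\<bar>n\<bar> \<le> D" "\<bar>k\<bar> \<le> D"
      using D nz abs_ge_zero[of k] unfolding mult.assoc mult_1_left mult_1_right by linarith+
    then show "f \<in> {- D..D} \<times> {- D..D} \<times> {- D..D}"
      by (simp add: fmnk abs_le_iff)
  qed
qed

text \<open>Once \<open>\<xi>\<^sup>-\<close> is negative after the first step, the next form is reduced, and so are all later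
  ones. If \<open>\<xi>\<^sup>-\<close> stayed positive for ever, the two roots would have the same partial quotients from
  the first step on, hence coincide.\<close>

lemma eventually_reduced:
  assumes "nonsquare_form f"
  shows "\<exists>N. \<forall>i\<ge>N. reduced (cf_form f i)"
proof -
  define x where "x i = xi_plus (cf_form f i)" for i
  define c where "c i = xi_plus (adjoint_form (cf_form f i))" for i
  have ns: "nonsquare_form (cf_form f i)" for i using nonsquare_cf_form assms by blast
  have x_gt: "x i > 1" if "i > 0" for i
    unfolding x_def xi_plus_cf_form[OF assms]
    using complete_quotient_gt_1 xi_plus_irrational assms that by blast
  have a_ge: "1 \<le> real_of_int \<lfloor>x i\<rfloor>" if "i > 0" for i
    using x_gt[OF that] by (simp add: le_floor_iff)
  have c_Suc: "c (Suc i) = of_int \<lfloor>x i\<rfloor> + 1 / c i" for i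
    unfolding c_def x_def cf_form_simps by (rule xi_plus_adjoint_cf_step[OF ns])
  show ?thesis
  proof (cases "\<exists>i>0. c i > 0")
    case True
    then obtain i where i: "i > 0" "c i > 0" by blast
    have pos: "c j > 0" if "j \<ge> i" for j
      using that
    proof (induction j rule: dec_induct)
      case (step j)
      then show ?case unfolding c_Suc using a_ge[of j] i by (simp add: add_pos_pos)
    qed (use i in simp)
    have "reduced (cf_form f j)" if ji: "j \<ge> Suc i" for j
    proof -
      obtain j' where j: "j = Suc j'" using ji by (cases j) auto
      then have j': "j' \<ge> i" using ji by simp
      have "1 / c j' > 0" using pos[OF j'] by simp
      moreover have "1 \<le> real_of_int \<lfloor>x j'\<rfloor>" using a_ge i(1) j' by simp
      ultimately have "c j > 1" unfolding j c_Suc by linarith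
      then show ?thesis using x_gt[of j] j unfolding reduced_def x_def c_def by simp
    qed
    then show ?thesis by blast
  next
    case False
    have c_neg: "c i < 0" if "i > 0" for i
    proof -
      have "c i \<noteq> 0" unfolding c_def using xi_plus_irrational[of "adjoint_form (cf_form f i)"] ns by auto
      then show ?thesis using False that by (metis linorder_neqE_linordered_idom)
    qed
    define z where "z i = - 1 / c i" for i
    have z_pos: "z i > 0" if "i > 0" for i using c_neg[OF that] by (simp add: z_def field_simps)
    have z_rec: "z i = of_int \<lfloor>x i\<rfloor> + 1 / z (Suc i)" for i
      using c_Suc[of i] by (simp add: z_def)
    have z_gt: "z i > 1" if "i > 0" for i
    proof -
      have "1 / z (Suc i) > 0" using z_pos[of "Suc i"] by simp
      then show ?thesis using z_rec[of i] a_ge[OF that] by linarith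
    qed
    note step = expansion_step[OF z_rec z_gt[OF zero_less_Suc]]
    have cq: "complete_quotient (z 1) i = z (Suc i)" for i
      by (induction i) (simp_all add: step)
    have "partial_quotient (z 1) i = partial_quotient (x 1) i" for i
      unfolding partial_quotient_def cq step(1)
      by (simp add: x_def xi_plus_cf_form[OF assms] complete_quotient_add
          del: cf_form_simps complete_quotient.simps)
    moreover have "z 1 \<notin> \<rat>" "x 1 \<notin> \<rat>"
      unfolding z_def c_def x_def using xi_plus_irrational ns
      by (simp_all add: minus_divide_left[symmetric] del: cf_form_simps)
    ultimately have "x 1 = z 1" using partial_quotients_inject by metis
    then show ?thesis using xi_plus_neq_conjugate[OF ns, of 1] unfolding x_def z_def c_def by blast
  qed
qed

lemma cf_form_period_mult:
  assumes "cf_form f p = f"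
  shows "cf_form f (n * p) = f"
proof (induction n)
  case (Suc n)
  have "cf_form f (Suc n * p) = cf_form (cf_form f p) (n * p)" by (simp add: cf_form_add)
  then show ?case using Suc assms by simp
qed simp

text \<open>Lagrange: the algorithm runs through finitely many reduced forms, so one of them recurs. The
  period \<open>L\<close> obtained here need not be minimal, and doubling it makes it even.\<close>

theorem cf_form_eventually_periodic:
  assumes "nonsquare_form f"
  obtains N L where "L > 0" "even L" "\<And>i. reduced (cf_form f (N + i))"
    "cf_form (cf_form f N) L = cf_form f N"
proof -
  obtain N0 where N0: "\<And>i. i \<ge> N0 \<Longrightarrow> reduced (cf_form f i)"
    using eventually_reduced[OF assms] by blast
  let ?F = "\<lambda>i. cf_form f (N0 + i)"
  have "range ?F \<subseteq> {g. nonsquare_form g \<and> discriminant g = discriminant f \<and> reduced g}"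
    using N0[OF le_add1] nonsquare_cf_form[OF assms] gl_equiv_discriminant[OF gl_equiv_cf_form]
    by blast
  then have "finite (range ?F)" using finite_reduced_forms finite_subset by blast
  then have "\<not> inj ?F" using finite_imageD infinite_UNIV_nat by blast
  then obtain i j where ij: "i < j" "?F i = ?F j"
    unfolding inj_def by (metis linorder_neqE_nat)
  define N where "N = N0 + i"
  have "N + (j - i) = N0 + j" using ij(1) by (simp add: N_def)
  then have "cf_form (cf_form f N) (j - i) = cf_form f N"
    using ij(2) by (metis cf_form_add N_def)
  then have "cf_form (cf_form f N) (2 * (j - i)) = cf_form f N"
    by (rule cf_form_period_mult)
  moreover have "2 * (j - i) > 0" "even (2 * (j - i))" using ij by auto
  moreover have "reduced (cf_form f (N + i'))" for i' using N0 by (simp add: N_def)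
  ultimately show ?thesis using that by blast
qed

section \<open>The adjoint form has the reversed continued fraction\<close>

text \<open>Galois: since \<open>\<xi>(f'\<^sup>*) = a + 1 / \<xi>(f\<^sup>*)\<close> when \<open>f'\<close> is the successor of \<open>f\<close>, the algorithm
  applied to the adjoints of a chain of reduced forms runs through the chain backwards.\<close>

lemma complete_quotient_adjoint:
  assumes "nonsquare_form f" "\<And>i. reduced (cf_form f i)" "j \<le> i"
  shows "complete_quotient (xi_plus (adjoint_form (cf_form f i))) j
    = xi_plus (adjoint_form (cf_form f (i - j)))"
  using assms(3)
proof (induction j)
  case (Suc j)
  let ?g = "cf_form f (i - Suc j)"
  have "cf_form f (i - j) = cf_step ?g"
    using Suc.prems by (metis Suc_diff_Suc Suc_le_lessD cf_form_simps(2))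
  then have "xi_plus (adjoint_form (cf_form f (i - j)))
      = of_int \<lfloor>xi_plus ?g\<rfloor> + 1 / xi_plus (adjoint_form ?g)"
    using xi_plus_adjoint_cf_step[OF nonsquare_cf_form[OF assms(1)]] by metis
  moreover have "xi_plus (adjoint_form ?g) > 1"
    using assms(2) unfolding reduced_def by blast
  ultimately show ?case using Suc expansion_step(2) by simp
qed simp

lemma partial_quotient_adjoint:
  assumes "nonsquare_form f" "\<And>i. reduced (cf_form f i)" "cf_form f p = f" "j < p"
  shows "partial_quotient (xi_plus (adjoint_form f)) j = partial_quotient (xi_plus f) (p - Suc j)"
proof -
  let ?g = "cf_form f (p - Suc j)"
  have "complete_quotient (xi_plus (adjoint_form f)) j = xi_plus (adjoint_form (cf_form f (p - j)))"
    using complete_quotient_adjoint[OF assms(1,2), of j p] assms(3,4) by simp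
  also have "cf_form f (p - j) = cf_step ?g"
    using assms(4) by (metis Suc_diff_Suc cf_form_simps(2))
  also have "xi_plus (adjoint_form (cf_step ?g))
      = of_int \<lfloor>xi_plus ?g\<rfloor> + 1 / xi_plus (adjoint_form ?g)"
    by (rule xi_plus_adjoint_cf_step[OF nonsquare_cf_form[OF assms(1)]])
  finally have "\<lfloor>complete_quotient (xi_plus (adjoint_form f)) j\<rfloor> = \<lfloor>xi_plus ?g\<rfloor>"
    by (rule expansion_step(1)) (use assms(2) reduced_def in blast)
  then show ?thesis by (simp add: partial_quotient_def xi_plus_cf_form[OF assms(1)])
qed

section \<open>Minimal blocks of eventually periodic sequences\<close>

lemma repeating_block_imp_periodic:
  assumes "repeating_block a w"
  shows "\<exists>N. \<forall>i\<ge>N. a (i + length w) = a i"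
proof -
  obtain N where N: "\<And>i. a (N + i) = w ! (i mod length w)"
    using assms unfolding repeating_block_def by blast
  have "a (i + length w) = a i" if iN: "i \<ge> N" for i
  proof -
    obtain t where "i = N + t" using le_Suc_ex[OF iN] by blast
    then show ?thesis using N[of t] N[of "t + length w"] by (simp add: add.assoc)
  qed
  then show ?thesis by blast
qed

lemma periodic_imp_repeating_block:
  assumes "p > 0" "\<And>i. i \<ge> N \<Longrightarrow> a (i + p) = a i"
  shows "repeating_block a (map a [N..<N + p])"
proof -
  have shift: "a (N + i + q * p) = a (N + i)" for i q
  proof (induction q)
    case (Suc q)
    then show ?case using assms(2)[of "N + i + q * p"] by (simp add: add_ac)
  qed simp
  have "a (N + i) = map a [N..<N + p] ! (i mod p)" for i
    using shift[of "i mod p" "i div p"] assms(1) by (simp add: add.assoc)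
  then show ?thesis unfolding repeating_block_def using assms(1) by auto
qed

lemma minimal_blocks_nonempty:
  assumes "repeating_block a v"
  shows "\<exists>w. w \<in> minimal_blocks a"
  using ex_has_least_nat[of "repeating_block a" v length, OF assms]
  unfolding minimal_blocks_def mem_Collect_eq .

lemma minimal_blocks_length_eq:
  "w \<in> minimal_blocks a \<Longrightarrow> v \<in> minimal_blocks a \<Longrightarrow> length v = length w"
  unfolding minimal_blocks_def by (blast intro: le_antisym)

text \<open>Otherwise the remainder of \<open>p\<close> modulo the minimal length would be a smaller period.\<close>

lemma minimal_block_length_dvd:
  assumes w: "w \<in> minimal_blocks a" and p: "\<And>i. i \<ge> N \<Longrightarrow> a (i + p) = a i"
  shows "length w dvd p"
proof (rule ccontr)
  assume nd: "\<not> length w dvd p"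
  define l where "l = length w"
  define r where "r = p mod l"
  obtain M where M: "\<And>i. i \<ge> M \<Longrightarrow> a (i + l) = a i"
    using w repeating_block_imp_periodic unfolding minimal_blocks_def l_def by blast
  have Mq: "a (i + q * l) = a i" if "i \<ge> M" for i q
  proof (induction q)
    case (Suc q)
    then show ?case using M[of "i + q * l"] that by (simp add: add_ac)
  qed simp
  have "a (i + r) = a i" if "i \<ge> max M N" for i
  proof -
    have "a (i + r) = a (i + r + (p div l) * l)" using Mq[of "i + r" "p div l"] that by simp
    also have "i + r + (p div l) * l = i + p" by (simp add: r_def)
    also have "a (i + p) = a i" using p that by simp
    finally show ?thesis .
  qed
  moreover have "r > 0" using nd by (simp add: r_def l_def dvd_eq_mod_eq_0)
  ultimately have "repeating_block a (map a [max M N..<max M N + r])"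
    by (intro periodic_imp_repeating_block) auto
  then have "l \<le> r" using w unfolding minimal_blocks_def l_def by fastforce
  moreover have "l > 0" using w unfolding minimal_blocks_def repeating_block_def l_def by simp
  ultimately show False unfolding r_def using mod_less_divisor[of l p] by linarith
qed

section \<open>Symmetries of the class and symmetries of the period\<close>

text \<open>A substitution of determinant \<open>-1\<close> that fixes \<open>\<xi>\<close> is the same as an odd shift between two equal
  tails of its expansion, that is, an odd period. If the minimal period is even, it divides every
  period and there is none.\<close>

lemma gl_equiv_self_iff_odd:
  assumes f: "nonsquare_form f" and w: "w \<in> minimal_blocks (partial_quotient (xi_plus f))"
  shows "gl_equiv (- 1) f f \<longleftrightarrow> odd (length w)"
proof
  let ?x = "xi_plus f"
  assume "gl_equiv (- 1) f f"
  then have "tail_equiv (- 1) ?x ?x" using gl_equiv_iff_tail_equiv f by blast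
  then obtain i j where ij: "complete_quotient ?x i = complete_quotient ?x j"
    and odd: "(- 1 :: int) ^ (i + j) = - 1"
    unfolding tail_equiv_def by blast
  have odd': "odd (i + j)"
  proof
    assume "even (i + j)"
    then show False using odd by simp
  qed
  have main: "odd (length w)"
    if "i < j" "complete_quotient ?x i = complete_quotient ?x j" "odd (i + j)" for i j
  proof -
    have "partial_quotient ?x (t + (j - i)) = partial_quotient ?x t" if "t \<ge> i" for t
    proof -
      have "t + (j - i) = j + (t - i)" "t = i + (t - i)" using that \<open>i < j\<close> by auto
      then show ?thesis using that(1) \<open>complete_quotient ?x i = _\<close> partial_quotient_add by metis
    qed
    then have "length w dvd j - i" by (rule minimal_block_length_dvd[OF w])
    moreover have "odd (j - i)" using that(1,3) by (simp add: even_diff_nat add.commute)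
    ultimately show ?thesis using dvd_trans by blast
  qed
  have "i \<noteq> j" using odd' by auto
  then show "odd (length w)" using main ij odd' by (metis add.commute linorder_neqE_nat)
next
  let ?x = "xi_plus f"
  assume odd: "odd (length w)"
  obtain N where N: "\<And>i. i \<ge> N \<Longrightarrow> partial_quotient ?x (i + length w) = partial_quotient ?x i"
    using w repeating_block_imp_periodic unfolding minimal_blocks_def by blast
  have "complete_quotient ?x (N + length w) = complete_quotient ?x N"
  proof (rule partial_quotients_inject)
    show "complete_quotient ?x (N + length w) \<notin> \<rat>" "complete_quotient ?x N \<notin> \<rat>"
      using complete_quotient_irrational xi_plus_irrational f by blast+
    show "partial_quotient (complete_quotient ?x (N + length w)) i
      = partial_quotient (complete_quotient ?x N) i" for i
      using N[of "N + i"] by (simp add: partial_quotient_add add_ac)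
  qed
  then have "tail_equiv (- 1) ?x ?x"
    unfolding tail_equiv_def using odd
    by (intro exI[of _ "N + length w"] exI[of _ N]) simp
  then show "gl_equiv (- 1) f f" using gl_equiv_iff_tail_equiv f by blast
qed

text \<open>Starting the algorithm at a palindromic block yields a form that is equal to its own
  adjoint: the partial quotients of the adjoint are the reversed ones, which here are the same.\<close>

lemma palindromic_block_imp_adjoint:
  assumes f: "nonsquare_form f"
    and w: "w \<in> minimal_blocks (partial_quotient (xi_plus f))" "rev w = w"
  shows "gl_equiv 1 f (adjoint_form f)"
proof -
  let ?x = "xi_plus f"
  define l where "l = length w"
  obtain N where red: "\<And>i. reduced (cf_form f (N + i))"
    using cf_form_eventually_periodic[OF f] by metis
  obtain N0 where w0: "w \<noteq> []" and N0: "\<And>i. partial_quotient ?x (N0 + i) = w ! (i mod l)"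
    using w(1) unfolding minimal_blocks_def repeating_block_def l_def by blast
  have l: "l > 0" using w0 by (simp add: l_def)
  (* a place in the reduced range at which a copy of \<open>w\<close> begins *)
  define M where "M = N0 + l * N"
  define h where "h = cf_form f M"
  have h: "nonsquare_form h" unfolding h_def using nonsquare_cf_form f by blast
  have "N \<le> M" using l by (simp add: M_def trans_le_add2)
  then have redh: "reduced (cf_form h i)" for i
    using red[of "M - N + i"] by (simp add: h_def cf_form_add)
  have pq: "partial_quotient (xi_plus h) i = w ! (i mod l)" for i
    using N0[of "l * N + i"]
    by (simp add: h_def xi_plus_cf_form f partial_quotient_add M_def add.assoc)
  have "xi_plus (cf_form h l) = xi_plus h"
  proof (rule partial_quotients_inject)
    show "xi_plus (cf_form h l) \<notin> \<rat>" "xi_plus h \<notin> \<rat>"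
      using xi_plus_irrational nonsquare_cf_form h by blast+
    show "partial_quotient (xi_plus (cf_form h l)) i = partial_quotient (xi_plus h) i" for i
      by (simp add: xi_plus_cf_form h partial_quotient_add pq)
  qed
  then have "cf_form h l = h"
    using h gl_equiv_discriminant[OF gl_equiv_cf_form]
    by (intro xi_plus_inject nonsquare_cf_form) auto
  then have per: "cf_form h (q * l) = h" for q by (rule cf_form_period_mult)
  have "partial_quotient (xi_plus (adjoint_form h)) j = partial_quotient (xi_plus h) j" for j
  proof -
    have r: "j mod l < l" using l by simp
    have "j < Suc j * l" using l by (cases l) auto
    then have "partial_quotient (xi_plus (adjoint_form h)) j = w ! ((Suc j * l - Suc j) mod l)"
      using partial_quotient_adjoint[OF h redh per[of "Suc j"]] pq by (simp only:)
    also have "Suc j * l - Suc j = (l - Suc (j mod l)) + (j - j div l) * l"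
    proof -
      have "j = j div l * l + j mod l" by simp
      moreover have "j div l \<le> j" by simp
      then have "(j - j div l) * l + j div l * l = j * l"
        by (simp flip: add_mult_distrib)
      ultimately show ?thesis using r unfolding mult_Suc by linarith
    qed
    also have "\<dots> mod l = l - Suc (j mod l)"
      unfolding mod_mult_self1 using r by (intro mod_less) linarith
    also have "w ! (l - Suc (j mod l)) = rev w ! (j mod l)"
      using r by (simp add: rev_nth l_def)
    finally show ?thesis using w(2) pq by simp
  qed
  then have "xi_plus (adjoint_form h) = xi_plus h"
    using h by (intro partial_quotients_inject xi_plus_irrational) auto
  then have "adjoint_form h = h" using h by (intro xi_plus_inject) auto
  then have "gl_equiv 1 h (adjoint_form h)" using gl_equiv_refl by simp
  moreover have fh: "gl_equiv ((- 1) ^ M) f h" unfolding h_def by (rule gl_equiv_cf_form)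
  ultimately have "gl_equiv ((- 1) ^ M * 1 * (- 1) ^ M) f (adjoint_form f)"
    using gl_equiv_trans gl_equiv_sym gl_equiv_adjoint by blast
  then show ?thesis by (simp add: power_add[symmetric])
qed

text \<open>Invariance under the adjoint makes a shift of the reversed expansion agree with the expansion,
  so the periodic part has a mirror symmetry \<open>t \<mapsto> c - t\<close>. The shift between the tails is even and
  the period is even, so \<open>c\<close> is odd. The centre \<open>c/2\<close> then lies between two places, and a block of
  even length can be placed symmetrically around it. With an odd shift the centre would be a place,
  and no block of even length would be symmetric about it.\<close>

lemma adjoint_imp_palindromic_block:
  assumes f: "nonsquare_form f" and adj: "gl_equiv 1 f (adjoint_form f)"
    and w: "w \<in> minimal_blocks (partial_quotient (xi_plus f))" "even (length w)"
  shows "\<exists>v\<in>minimal_blocks (partial_quotient (xi_plus f)). rev v = v"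
proof -
  define a where "a = partial_quotient (xi_plus f)"
  define l where "l = length w"
  obtain N L where NL: "L > 0" "even L" "\<And>i. reduced (cf_form f (N + i))"
    "cf_form (cf_form f N) L = cf_form f N"
    using cf_form_eventually_periodic[OF f] by metis
  define g where "g = cf_form f N"
  have g: "nonsquare_form g" unfolding g_def using nonsquare_cf_form f by blast
  have redg: "reduced (cf_form g i)" for i using NL(3) by (simp add: g_def cf_form_add)
  have b: "partial_quotient (xi_plus g) i = a (N + i)" for i
    by (simp add: g_def a_def xi_plus_cf_form f partial_quotient_add)
  have fg: "gl_equiv ((- 1) ^ N) f g" unfolding g_def by (rule gl_equiv_cf_form)
  then have "gl_equiv ((- 1) ^ N * 1 * (- 1) ^ N) g (adjoint_form g)"
    using adj gl_equiv_trans gl_equiv_sym gl_equiv_adjoint by blast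
  then have "gl_equiv 1 g (adjoint_form g)" by (simp add: power_add[symmetric])
  then have "tail_equiv 1 (xi_plus g) (xi_plus (adjoint_form g))"
    using gl_equiv_iff_tail_equiv g by simp
  then obtain i j where
    ij: "complete_quotient (xi_plus g) i = complete_quotient (xi_plus (adjoint_form g)) j"
    and "(- 1 :: int) ^ (i + j) = 1"
    unfolding tail_equiv_def by blast
  then have even_ij: "even (i + j)" by (metis neg_one_odd_power one_neq_neg_one)
  obtain M where M: "\<And>t. t \<ge> M \<Longrightarrow> a (t + l) = a t"
    using w(1) repeating_block_imp_periodic unfolding minimal_blocks_def a_def l_def by blast
  have l: "l > 0" using w(1) unfolding minimal_blocks_def repeating_block_def l_def by simp
  (* any multiple of the period serves; a large one puts the block \<open>q, \<dots>, q + l - 1\<close>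
     behind the preperiod and inside the range where the reversal is valid *)
  define n where "n = i + j + l + 2 * M"
  define K where "K = n * L"
  have K: "K \<ge> i + j + l + 2 * M" using NL(1) unfolding K_def n_def by simp
  have "even (K + i + j + l)" using NL(2) even_ij w(2) by (simp add: K_def l_def)
  moreover have "K + i - j - l = (K + i + j + l) - 2 * (j + l)" using K by simp
  ultimately have "even (K + i - j - l)" by (metis dvd_triv_left even_diff_nat dvd_diff_nat)
  (* the block has the same centre as the mirror: \<open>q + (q + l - 1) = (K + i - j) - 1\<close> *)
  then obtain q where "K + i - j - l = 2 * q" by (rule evenE)
  then have q: "2 * q + l + j = K + i" using K by simp
  have qi: "q \<ge> i + M" using q K by simp
  have mirror: "a (N + (q + u)) = a (N + (q + (l - Suc u)))" if "u < l" for u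
  proof -
    define r where "r = q + u - i"
    have r: "q + u = i + r" using qi by (simp add: r_def)
    have jr: "j + r < K" "K - Suc (j + r) = q + (l - Suc u)"
      using r q qi that by auto
    have per: "cf_form g K = g"
      unfolding K_def g_def by (rule cf_form_period_mult[OF NL(4)])
    have "partial_quotient (xi_plus g) (i + r) = partial_quotient (xi_plus (adjoint_form g)) (j + r)"
      using ij partial_quotient_add by metis
    also have "\<dots> = partial_quotient (xi_plus g) (K - Suc (j + r))"
      by (rule partial_quotient_adjoint[OF g redg per jr(1)])
    finally show ?thesis unfolding jr(2) b r .
  qed
  define v where "v = map a [N + q..<N + q + l]"
  have len: "length v = l" by (simp add: v_def)
  have "repeating_block a v"
    unfolding v_def using M qi l by (intro periodic_imp_repeating_block) auto
  then have "v \<in> minimal_blocks a"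
    using w(1) len unfolding minimal_blocks_def a_def l_def by simp
  moreover have "rev v = v"
  proof (rule nth_equalityI)
    fix u assume "u < length (rev v)"
    then have u: "u < l" using len by simp
    then have "rev v ! u = v ! (l - Suc u)" using len by (simp add: rev_nth)
    also have "\<dots> = a (N + (q + (l - Suc u)))" using u by (simp add: v_def add.assoc)
    also have "\<dots> = v ! u" using mirror[OF u] u by (simp add: v_def add.assoc)
    finally show "rev v ! u = v ! u" .
  qed simp
  ultimately show ?thesis unfolding a_def by blast
qed

lemma palindromic_even_iff:
  assumes "nonsquare_form f"
  defines "P \<equiv> minimal_blocks (partial_quotient (xi_plus f))"
  shows "palindromic_period P \<and> even_period P \<longleftrightarrow>
    gl_equiv 1 f (adjoint_form f) \<and> \<not> gl_equiv (- 1) f f"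
proof
  assume "palindromic_period P \<and> even_period P"
  then obtain w v where "w \<in> P" "rev w = w" "v \<in> P" "even (length v)"
    unfolding palindromic_period_def even_period_def by blast
  moreover from this have "even (length w)" using minimal_blocks_length_eq P_def by metis
  ultimately show "gl_equiv 1 f (adjoint_form f) \<and> \<not> gl_equiv (- 1) f f"
    using palindromic_block_imp_adjoint gl_equiv_self_iff_odd assms(1) unfolding P_def by blast
next
  assume R: "gl_equiv 1 f (adjoint_form f) \<and> \<not> gl_equiv (- 1) f f"
  obtain N L where NL: "L > 0" "cf_form (cf_form f N) L = cf_form f N"
    using cf_form_eventually_periodic[OF assms(1)] by metis
  then have "complete_quotient (xi_plus f) (N + L) = complete_quotient (xi_plus f) N"
    by (metis cf_form_add xi_plus_cf_form assms(1))
  then have "partial_quotient (xi_plus f) (N + L + t) = partial_quotient (xi_plus f) (N + t)" for t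
    by (metis partial_quotient_add)
  from this[of "i - N" for i]
  have "partial_quotient (xi_plus f) (i + L) = partial_quotient (xi_plus f) i" if "i \<ge> N" for i
    using that by (metis add.assoc add.commute le_add_diff_inverse)
  with NL(1) obtain v where "repeating_block (partial_quotient (xi_plus f)) v"
    using periodic_imp_repeating_block[where a = "partial_quotient (xi_plus f)" and N = N] by blast
  then obtain w where w: "w \<in> P" using minimal_blocks_nonempty unfolding P_def by blast
  then have "even (length w)" using R gl_equiv_self_iff_odd assms(1) unfolding P_def by blast
  then show "palindromic_period P \<and> even_period P"
    using adjoint_imp_palindromic_block assms(1) R w
    unfolding palindromic_period_def even_period_def P_def by blast
qed

text \<open>When \<open>\<xi>\<^sup>+\<close> is negative its absolute value is the root of \<open>-f(x, -y)\<close>, and passing to that form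
  preserves all the symmetries.\<close>

lemma absolute_root:
  assumes "nonsquare_form f"
  obtains e g where "gl_equiv e f g" "xi_plus g = \<bar>xi_plus f\<bar>"
proof (cases "xi_plus f \<ge> 0")
  case True
  then show ?thesis using that[OF gl_equiv_refl] by simp
next
  case False
  obtain m n k where f: "f = (m, n, k)" by (cases f)
  have "gl_equiv (- 1) f (- m, - n, k)"
    unfolding f gl_equiv_explicit
    by (rule exI[of _ 1], rule exI[of _ 0], rule exI[of _ 0], rule exI[of _ "- 1"]) simp
  moreover have "xi_plus (- m, - n, k) = - xi_plus f"
    by (simp add: f xi_plus_eq minus_divide_right[symmetric])
  then have "xi_plus (- m, - n, k) = \<bar>xi_plus f\<bar>" using False by simp
  ultimately show ?thesis using that by blast
qed

lemma gl_equiv_transfer: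
  assumes "gl_equiv e f g" "gl_equiv e f' g'"
  shows "gl_equiv d f f' \<longleftrightarrow> gl_equiv d g g'"
proof -
  have e: "e * (d * e) = d"
    using gl_equiv_unit[OF assms(1)] by (metis mult.left_commute mult_1_right)
  have "gl_equiv (e * d * e) g g'" if "gl_equiv d f f'"
    using gl_equiv_trans[OF gl_equiv_trans[OF gl_equiv_sym[OF assms(1)] that] assms(2)] .
  moreover have "gl_equiv (e * d * e) f f'" if "gl_equiv d g g'"
    using gl_equiv_trans[OF gl_equiv_trans[OF assms(1) that] gl_equiv_sym[OF assms(2)]] .
  ultimately show ?thesis using e by (auto simp: mult.assoc)
qed

theorem theorem3p5:
  fixes m n k :: int
  assumes "k\<^sup>2 - 4 * m * n > 0"
    and "\<not> is_square (k\<^sup>2 - 4 * m * n)"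
  shows "palindromic_period (Gamma_period (m, n, k)) \<and> even_period (Gamma_period (m, n, k)) \<longleftrightarrow>
         m_plus_n_symmetric (form_class (m, n, k))"
proof -
  let ?f = "(m, n, k)"
  have f: "nonsquare_form ?f" using assms by (simp add: nonsquare_form_def)
  obtain e g where fg: "gl_equiv e ?f g" "xi_plus g = \<bar>xi_plus ?f\<bar>"
    using absolute_root[OF f] .
  have "palindromic_period (Gamma_period ?f) \<and> even_period (Gamma_period ?f) \<longleftrightarrow>
      gl_equiv 1 g (adjoint_form g) \<and> \<not> gl_equiv (- 1) g g"
    using palindromic_even_iff[OF gl_equiv_nonsquare[OF fg(1) f]]
    unfolding Gamma_period_def fg(2)[symmetric] .
  also have "\<dots> \<longleftrightarrow> gl_equiv 1 ?f (adjoint_form ?f) \<and> \<not> gl_equiv (- 1) ?f ?f"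
    using gl_equiv_transfer fg(1) gl_equiv_adjoint by blast
  also have "\<dots> \<longleftrightarrow> m_plus_n_symmetric (form_class ?f)"
    by (rule m_plus_n_symmetric_iff[symmetric])
  finally show ?thesis .
qed

end
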